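(* Let $\mathbb{F}_q$ be a finite field with $q\equiv 1\pmod 3$ and let $\rho\in\mathbb{F}_q$ be a primitive cube root of unity. The family of elliptic curves $$E_a:\ y^2+(3a-1)xy+a(\rho-1)\Bigl(a-\frac{\rho+1}{3}\Bigr)y=x^3,\qquad a\in\mathbb{F}_q,\quad a\Bigl(a-\frac{\rho+1}{3}\Bigr)\Bigl(a-\frac{\rho}{3}\Bigr)\neq 0,$$ corresponds to all the elliptic curves defined over $\mathbb{F}_q$ with non-cyclic $3$-torsion subgroup; that is, each such $E_a$ is an elliptic curve with $E_a(\mathbb{F}_q)[3]$ non-cyclic, and every elliptic curve $E$ over $\mathbb{F}_q$ with $E(\mathbb{F}_q)[3]$ non-cyclic is isomorphic over $\mathbb{F}_q$ to some $E_a$ in the family. *)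

theory Defs
  imports "HOL-Algebra.Elementary_Groups" "HOL-Library.Cardinality"
begin

definition primitive_root_of_unity :: "nat \<Rightarrow> 'a::field \<Rightarrow> bool" where
  "primitive_root_of_unity n z \<longleftrightarrow> n > 0 \<and> z ^ n = 1 \<and> (\<forall>k. 0 < k \<and> k < n \<longrightarrow> z ^ k \<noteq> 1)"

(* Weierstrass a1 a2 a3 a4 a6 is the curve y^2 + a1 x y + a3 y = x^3 + a2 x^2 + a4 x + a6.
   Short Weierstrass form would not do, since characteristic 2 is allowed. *)
datatype 'a weierstrass = Weierstrass 'a 'a 'a 'a 'a

fun on_curve :: "'a::field weierstrass \<Rightarrow> 'a \<Rightarrow> 'a \<Rightarrow> bool" where
  "on_curve (Weierstrass a1 a2 a3 a4 a6) x y \<longleftrightarrow>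
     y^2 + a1*x*y + a3*y = x^3 + a2*x^2 + a4*x + a6"

fun discriminant :: "'a::field weierstrass \<Rightarrow> 'a" where
  "discriminant (Weierstrass a1 a2 a3 a4 a6) =
     (let b2 = a1^2 + 4*a2;
          b4 = 2*a4 + a1*a3;
          b6 = a3^2 + 4*a6;
          b8 = a1^2*a6 + 4*a2*a6 - a1*a3*a4 + a2*a3^2 - a4^2
      in - (b2^2 * b8) - 8*b4^3 - 27*b6^2 + 9*b2*b4*b6)"

definition elliptic_curve :: "'a::field weierstrass \<Rightarrow> bool" where
  "elliptic_curve E \<longleftrightarrow> discriminant E \<noteq> 0"

datatype 'a point = Infinity | Affine 'a 'a

fun curve_points :: "'a::field weierstrass \<Rightarrow> 'a point set" where
  "curve_points E = insert Infinity {Affine x y | x y. on_curve E x y}"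

(* Chord-tangent addition. The slope l is that of the chord through the two points, or of the
   tangent if they coincide; the line meets the curve again at x3, and the sum is the negative
   (x, y) |-> (x, - y - a1 x - a3) of that third point. In the tangent case x1 = x2, and two
   points of the curve that share x and are not mutually inverse are equal. *)
fun point_add :: "'a::field weierstrass \<Rightarrow> 'a point \<Rightarrow> 'a point \<Rightarrow> 'a point" where
  "point_add E Infinity Q = Q"
| "point_add E P Infinity = P"
| "point_add (Weierstrass a1 a2 a3 a4 a6) (Affine x1 y1) (Affine x2 y2) =
     (if x1 = x2 \<and> y1 + y2 + a1*x2 + a3 = 0 then Infinity
      else
        let l = (if x1 = x2
                 then (3*x1^2 + 2*a2*x1 + a4 - a1*y1) / (2*y1 + a1*x1 + a3)
                 else (y2 - y1) / (x2 - x1));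
            x3 = l^2 + a1*l - a2 - x1 - x2
        in Affine x3 (- (y1 + l*(x3 - x1)) - a1*x3 - a3))"

definition point_group :: "'a::field weierstrass \<Rightarrow> 'a point monoid" where
  "point_group E = \<lparr>carrier = curve_points E, mult = point_add E, one = Infinity\<rparr>"

definition torsion_subgroup :: "nat \<Rightarrow> ('a, 'b) monoid_scheme \<Rightarrow> ('a, 'b) monoid_scheme" where
  "torsion_subgroup n G = G\<lparr>carrier := {x \<in> carrier G. x [^]\<^bsub>G\<^esub> n = \<one>\<^bsub>G\<^esub>}\<rparr>"

(* The curve obtained by substituting x = u^2 x' + r, y = u^3 y' + u^2 s x' + t and dividing
   the equation by u^6; see on_curve_change_of_variables. *)
fun change_of_variables :: "'a::field \<Rightarrow> 'a \<Rightarrow> 'a \<Rightarrow> 'a \<Rightarrow> 'a weierstrass \<Rightarrow> 'a weierstrass" where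
  "change_of_variables u r s t (Weierstrass a1 a2 a3 a4 a6) =
     Weierstrass
       ((a1 + 2*s) / u)
       ((a2 - s*a1 + 3*r - s^2) / u^2)
       ((a3 + r*a1 + 2*t) / u^3)
       ((a4 - s*a3 + 2*r*a2 - (t + r*s)*a1 + 3*r^2 - 2*s*t) / u^4)
       ((a6 + r*a4 + r^2*a2 + r^3 - t*a3 - t^2 - r*t*a1) / u^6)"

lemma on_curve_change_of_variables:
  assumes "u \<noteq> 0"
  shows "on_curve (change_of_variables u r s t E) x y \<longleftrightarrow>
         on_curve E (u^2*x + r) (u^3*y + u^2*s*x + t)"
proof (cases E)
  case (Weierstrass a1 a2 a3 a4 a6)
  let ?F = "\<lambda>x y. y^2 + a1*x*y + a3*y - (x^3 + a2*x^2 + a4*x + a6)"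
  let ?b1 = "(a1 + 2*s) / u"
  let ?b2 = "(a2 - s*a1 + 3*r - s^2) / u^2"
  let ?b3 = "(a3 + r*a1 + 2*t) / u^3"
  let ?b4 = "(a4 - s*a3 + 2*r*a2 - (t + r*s)*a1 + 3*r^2 - 2*s*t) / u^4"
  let ?b6 = "(a6 + r*a4 + r^2*a2 + r^3 - t*a3 - t^2 - r*t*a1) / u^6"
  have b: "a1 + 2*s = u*?b1" "a2 - s*a1 + 3*r - s^2 = u^2*?b2" "a3 + r*a1 + 2*t = u^3*?b3"
    "a4 - s*a3 + 2*r*a2 - (t + r*s)*a1 + 3*r^2 - 2*s*t = u^4*?b4"
    "a6 + r*a4 + r^2*a2 + r^3 - t*a3 - t^2 - r*t*a1 = u^6*?b6"
    using assms by simp_all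
  have subst: "?F (u^2*x + r) (u^3*y + u^2*s*x + t) =
      u^6 * (y^2 + b1*x*y + b3*y - (x^3 + b2*x^2 + b4*x + b6))"
    if "a1 + 2*s = u*b1" "a2 - s*a1 + 3*r - s^2 = u^2*b2" "a3 + r*a1 + 2*t = u^3*b3"
      "a4 - s*a3 + 2*r*a2 - (t + r*s)*a1 + 3*r^2 - 2*s*t = u^4*b4"
      "a6 + r*a4 + r^2*a2 + r^3 - t*a3 - t^2 - r*t*a1 = u^6*b6" for b1 b2 b3 b4 b6
    using that by algebra
  show ?thesis
    using subst[OF b] assms unfolding Weierstrass
    by (simp only: change_of_variables.simps on_curve.simps)
       (metis eq_iff_diff_eq_0 mult_eq_0_iff power_not_zero)
qed

(* Isomorphism over the base field: an isomorphism of Weierstrass curves that fixes the point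
   at infinity is an admissible change of variables with coefficients in that field. *)
definition isomorphic_curves :: "'a::field weierstrass \<Rightarrow> 'a weierstrass \<Rightarrow> bool" where
  "isomorphic_curves E E' \<longleftrightarrow> (\<exists>u r s t. u \<noteq> 0 \<and> E' = change_of_variables u r s t E)"

definition family_curve :: "'a::field \<Rightarrow> 'a \<Rightarrow> 'a weierstrass" where
  "family_curve \<rho> a = Weierstrass (3*a - 1) 0 (a * (\<rho> - 1) * (a - (\<rho> + 1) / 3)) 0 0"

end

theory Submission
  imports Defs
begin

text \<open>
  An affine point is \<open>3\<close>-torsion iff it is a nonsingular flex. Moving one flex to the origin with
  tangent \<open>y = 0\<close> gives the curve \<open>y (y + A x + B) = x\<^sup>3\<close>. A second flex with \<open>x \<noteq> 0\<close> can be written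
  as \<open>(k c, k c\<^sup>2)\<close>; then \<open>B = k c (k - c - A)\<close> and the flex condition becomes
  \<open>A\<^sup>2 + 3 (c - k) A + 3 (k\<^sup>2 - k c + c\<^sup>2) = 0\<close>, which splits over a field with a primitive cube
  root of unity \<open>\<rho>\<close>. Up to replacing the flex by its negative, which maps \<open>(k, c)\<close> to \<open>(-c, -k)\<close>, we get
  \<open>A = (1 - \<rho>\<^sup>2) k + (\<rho> - 1) c\<close>. The remaining parameter \<open>[k : c]\<close>, suitably scaled, is \<open>a\<close>.
\<close>

section \<open>Negation and the points of order dividing three\<close>

fun point_neg :: "'a::field weierstrass \<Rightarrow> 'a point \<Rightarrow> 'a point" where
  "point_neg E Infinity = Infinity"
| "point_neg (Weierstrass a1 a2 a3 a4 a6) (Affine x y) = Affine x (- y - a1*x - a3)"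

lemma point_neg_neg [simp]: "point_neg E (point_neg E P) = P"
  by (cases E; cases P) auto

lemma point_add_Infinity_right [simp]: "point_add E P Infinity = P"
  by (cases P) auto

lemma point_add_eq_Infinity_iff: "point_add E P Q = Infinity \<longleftrightarrow> Q = point_neg E P"
proof (cases E)
  case (Weierstrass a1 a2 a3 a4 a6)
  have "y + y' + a1*x + a3 = 0 \<longleftrightarrow> y' = - y - a1*x - a3" for x y y'
    by (auto simp: algebra_simps eq_neg_iff_add_eq_0)
  then show ?thesis
    by (cases P; cases Q) (auto simp: Weierstrass Let_def)
qed

abbreviation torsion3 :: "'a::field weierstrass \<Rightarrow> 'a point monoid" where
  "torsion3 E \<equiv> torsion_subgroup 3 (point_group E)"

lemma torsion3_simps [simp]:
  "mult (torsion3 E) = point_add E" "one (torsion3 E) = Infinity"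
  by (auto simp: torsion_subgroup_def point_group_def)

text \<open>The power unfolds to \<open>(P + P) + P\<close>, which is \<open>Infinity\<close> iff
  \<open>P\<close> is the negative of \<open>P + P\<close>; negation is an involution, so the
  equation can be turned round.\<close>

lemma in_torsion3_iff:
  "P \<in> carrier (torsion3 E) \<longleftrightarrow> P \<in> curve_points E \<and> point_add E P P = point_neg E P"
proof -
  have "P [^]\<^bsub>point_group E\<^esub> (3::nat) = point_add E (point_add E P P) P"
    by (simp add: nat_pow_def numeral_3_eq_3 point_group_def)
  moreover have "P = point_neg E R \<longleftrightarrow> R = point_neg E P" for R
    by auto
  moreover have carr: "carrier (point_group E) = curve_points E"
    and one: "one (point_group E) = Infinity"
    by (simp_all add: point_group_def)
  ultimately show ?thesis
    by (simp add: torsion_subgroup_def point_add_eq_Infinity_iff carr one del: curve_points.simps)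
qed

lemma Infinity_in_torsion3: "Infinity \<in> carrier (torsion3 E)"
  by (simp add: in_torsion3_iff)

text \<open>\<open>N / D\<close> is the slope of the tangent. Tripling to \<open>Infinity\<close>
  means that the tangent meets the curve a third time at the same abscissa; the equation is
  \<open>x3 = x\<close> with the denominator cleared. The case \<open>D = 0\<close> is that of a
  point doubling to \<open>Infinity\<close>.\<close>

lemma Affine_in_torsion3_iff:
  fixes a1 :: "'a::field"
  assumes "E = Weierstrass a1 a2 a3 a4 a6"
  defines "D \<equiv> \<lambda>x y. 2*y + a1*x + a3"
    and "N \<equiv> \<lambda>x y. 3*x^2 + 2*a2*x + a4 - a1*y"
  shows "Affine x y \<in> carrier (torsion3 E) \<longleftrightarrow>
    on_curve E x y \<and> D x y \<noteq> 0 \<and> (N x y)^2 + a1 * N x y * D x y = (a2 + 3*x) * (D x y)^2"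
proof -
  define d n l x3 where "d = D x y" and "n = N x y" and "l = n / d"
    and "x3 = l^2 + a1*l - a2 - x - x"
  have "point_add E (Affine x y) (Affine x y) =
      (if d = 0 then Infinity else Affine x3 (- (y + l*(x3 - x)) - a1*x3 - a3))"
  proof -
    have "y + y + a1*x + a3 = d"
      by (simp add: d_def D_def)
    then show ?thesis
      unfolding assms(1) point_add.simps Let_def x3_def l_def n_def d_def D_def N_def by simp
  qed
  then have "point_add E (Affine x y) (Affine x y) = point_neg E (Affine x y) \<longleftrightarrow>
      d \<noteq> 0 \<and> x3 = x"
    by (cases "x3 = x") (simp_all add: assms(1))
  moreover have "x3 = x \<longleftrightarrow> n^2 + a1*n*d = (a2 + 3*x)*d^2" if "d \<noteq> 0"
  proof -
    have n: "n = l*d"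
      using that by (simp add: l_def)
    have "n^2 + a1*n*d - (a2 + 3*x)*d^2 = (x3 - x) * d^2"
      unfolding n x3_def by algebra
    moreover have "d^2 \<noteq> 0"
      using that by simp
    ultimately show ?thesis
      by (metis eq_iff_diff_eq_0 mult_eq_0_iff)
  qed
  moreover have "Affine x y \<in> curve_points E \<longleftrightarrow> on_curve E x y"
    by simp
  ultimately show ?thesis
    unfolding in_torsion3_iff d_def[symmetric] n_def[symmetric] by blast
qed

text \<open>Negation sends \<open>D\<close> to \<open>-D\<close> and \<open>N\<close> to
  \<open>N + a1*D\<close>, which merely swaps the two factors of \<open>N * (N + a1*D)\<close>, the
  left side of the flex equation.\<close>

lemma point_neg_in_torsion3:
  assumes "P \<in> carrier (torsion3 E)"
  shows "point_neg E P \<in> carrier (torsion3 E)"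
proof (cases P)
  case Infinity
  then show ?thesis
    by (simp add: Infinity_in_torsion3)
next
  case (Affine x y)
  obtain a1 a2 a3 a4 a6 where E: "E = Weierstrass a1 a2 a3 a4 a6"
    by (cases E)
  define d n where "d = 2*y + a1*x + a3" and "n = 3*x^2 + 2*a2*x + a4 - a1*y"
  have d': "2*(- y - a1*x - a3) + a1*x + a3 = - d"
    unfolding d_def by algebra
  have n': "3*x^2 + 2*a2*x + a4 - a1*(- y - a1*x - a3) = n + a1*d"
    unfolding d_def n_def by algebra
  have "(n + a1*d)^2 + a1*(n + a1*d)*(- d) = n^2 + a1*n*d"
    by algebra
  moreover have "(- y - a1*x - a3)^2 + a1*x*(- y - a1*x - a3) + a3*(- y - a1*x - a3)
      = y^2 + a1*x*y + a3*y"
    by algebra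
  moreover have "on_curve E x y" "d \<noteq> 0" "n^2 + a1*n*d = (a2 + 3*x)*d^2"
    using assms unfolding Affine Affine_in_torsion3_iff[OF E] d_def n_def by simp_all
  ultimately show ?thesis
    unfolding Affine E point_neg.simps Affine_in_torsion3_iff[OF refl] d' n' on_curve.simps by simp
qed

section \<open>Cyclicity of the 3-torsion in terms of points\<close>

lemma m_inv_torsion3:
  assumes "P \<in> carrier (torsion3 E)"
  shows "inv\<^bsub>torsion3 E\<^esub> P = point_neg E P"
  unfolding m_inv_def
proof (rule the_equality)
  show "point_neg E P \<in> carrier (torsion3 E) \<and>
      P \<otimes>\<^bsub>torsion3 E\<^esub> point_neg E P = \<one>\<^bsub>torsion3 E\<^esub> \<and>
      point_neg E P \<otimes>\<^bsub>torsion3 E\<^esub> P = \<one>\<^bsub>torsion3 E\<^esub>"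
    using point_neg_in_torsion3[OF assms] by (simp add: point_add_eq_Infinity_iff)
qed (simp add: point_add_eq_Infinity_iff[of E P])

text \<open>Since \<open>P + P\<close> is the negative of \<open>P\<close>, these three points are
  already closed under addition.\<close>

lemma generate_torsion3:
  assumes P: "P \<in> carrier (torsion3 E)"
  shows "generate (torsion3 E) {P} = {Infinity, P, point_neg E P}"
proof (intro equalityI subsetI)
  have add: "point_add E P P = point_neg E P" "point_add E (point_neg E P) (point_neg E P) = P"
    using P point_neg_in_torsion3[OF P] by (simp_all add: in_torsion3_iff)
  have cancel: "point_add E P (point_neg E P) = Infinity" "point_add E (point_neg E P) P = Infinity"
    by (simp_all add: point_add_eq_Infinity_iff)
  show "Q \<in> {Infinity, P, point_neg E P}" if "Q \<in> generate (torsion3 E) {P}" for Q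
    using that by induction (auto simp: m_inv_torsion3[OF P] add cancel)
  show "Q \<in> generate (torsion3 E) {P}" if "Q \<in> {Infinity, P, point_neg E P}" for Q
    using that generate.one[of "torsion3 E"] generate.incl[of P "{P}" "torsion3 E"]
      generate.inv[of P "{P}" "torsion3 E"]
    by (auto simp: m_inv_torsion3[OF P])
qed

lemma cyclic_torsion3_iff:
  fixes E :: "'a::field weierstrass"
  shows "cyclic_group (torsion3 E) \<longleftrightarrow>
    (\<exists>P \<in> carrier (torsion3 E). carrier (torsion3 E) = {Infinity, P, point_neg E P})"
proof -
  \<comment> \<open>\<open>cyclic_group\<close> asks for equality of whole records; as only the
    carrier is updated, this is equality of carriers.\<close>
  have upd: "r\<lparr>carrier := X\<rparr> = r \<longleftrightarrow> carrier r = X" for r :: "'a point monoid" and X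
    by (metis partial_object.select_convs(1) partial_object.surjective partial_object.update_convs(1))
  have "subgroup_generated (torsion3 E) {P} = torsion3 E \<longleftrightarrow>
      carrier (torsion3 E) = {Infinity, P, point_neg E P}" if "P \<in> carrier (torsion3 E)" for P
  proof -
    have "carrier (torsion3 E) \<inter> {P} = {P}"
      using that by blast
    then show ?thesis
      by (simp only: subgroup_generated_def upd generate_torsion3[OF that])
  qed
  then show ?thesis
    unfolding cyclic_group_def by (rule bex_cong[OF refl])
qed

lemma noncyclic_torsion3_iff:
  "\<not> cyclic_group (torsion3 E) \<longleftrightarrow>
    (\<exists>P Q. P \<in> carrier (torsion3 E) \<and> Q \<in> carrier (torsion3 E) \<and>
       P \<noteq> Infinity \<and> Q \<noteq> Infinity \<and> Q \<noteq> P \<and> Q \<noteq> point_neg E P)" (is "_ \<longleftrightarrow> ?R")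
proof
  assume nc: "\<not> cyclic_group (torsion3 E)"
  \<comment> \<open>The trivial group would be cyclic with generator
    \<open>Infinity\<close>.\<close>
  have "carrier (torsion3 E) \<noteq> {Infinity}"
    using nc unfolding cyclic_torsion3_iff by (metis insert_absorb2 insertI1 point_neg.simps(1))
  then obtain P where P: "P \<in> carrier (torsion3 E)" "P \<noteq> Infinity"
    using Infinity_in_torsion3[of E] by blast
  have "carrier (torsion3 E) \<noteq> {Infinity, P, point_neg E P}"
    using nc P unfolding cyclic_torsion3_iff by blast
  then show ?R
    using P Infinity_in_torsion3[of E] point_neg_in_torsion3[OF P(1)] by blast
next
  assume ?R
  then obtain P Q where PQ: "P \<in> carrier (torsion3 E)" "Q \<in> carrier (torsion3 E)"
    "P \<noteq> Infinity" "Q \<noteq> Infinity" "Q \<noteq> P" "Q \<noteq> point_neg E P"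
    by blast
  show "\<not> cyclic_group (torsion3 E)"
  proof
    assume "cyclic_group (torsion3 E)"
    then obtain R where "carrier (torsion3 E) = {Infinity, R, point_neg E R}"
      unfolding cyclic_torsion3_iff by blast
    then have "P \<in> {R, point_neg E R}" "Q \<in> {R, point_neg E R}"
      using PQ by auto
    then show False
      using PQ(5,6) by auto
  qed
qed

section \<open>Cube roots of unity and the members of the family\<close>

lemma primitive_cube_root:
  assumes "primitive_root_of_unity 3 (\<rho>::'a::field)"
  shows "\<rho>^2 + \<rho> + 1 = 0" "\<rho> \<noteq> 1" "(3::'a) \<noteq> 0"
proof -
  have r: "\<rho>^3 = 1" "\<rho>^1 \<noteq> 1"
    using assms unfolding primitive_root_of_unity_def by auto
  then show "\<rho> \<noteq> 1"
    by simp
  have "(\<rho> - 1) * (\<rho>^2 + \<rho> + 1) = 0"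
    using r(1) by algebra
  with \<open>\<rho> \<noteq> 1\<close> show "\<rho>^2 + \<rho> + 1 = 0"
    by simp
  show "(3::'a) \<noteq> 0"
  proof
    assume "(3::'a) = 0"
    \<comment> \<open>In characteristic 3 cubing is additive, so \<open>\<rho>^3 = 1\<close> would
      force \<open>\<rho> = 1\<close>.\<close>
    moreover have "(\<rho> - 1)^3 = 3 * (\<rho> - \<rho>^2) + (\<rho>^3 - 1)"
      by algebra
    ultimately have "(\<rho> - 1)^3 = 0"
      using r(1) by simp
    with \<open>\<rho> \<noteq> 1\<close> show False
      by simp
  qed
qed

text \<open>The curve \<open>y^2 + A*x*y + B*y = x^3\<close> has discriminant
  \<open>B^3 * (A^3 - 27*B)\<close>, and in the family the second factor is the cube of
  \<open>3*a - \<rho>\<close>.\<close>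

lemma elliptic_family_curve:
  fixes \<rho> :: "'a::field"
  assumes \<rho>: "primitive_root_of_unity 3 \<rho>"
    and a: "a * (a - (\<rho> + 1) / 3) * (a - \<rho> / 3) \<noteq> 0"
  shows "elliptic_curve (family_curve \<rho> a)"
proof -
  note r = primitive_cube_root[OF \<rho>]
  \<comment> \<open>With \<open>h\<close> in place of division by 3, the identities become
    polynomial consequences of \<open>3 * h = 1\<close> and
    \<open>\<rho>^2 + \<rho> + 1 = 0\<close>.\<close>
  define h where "h = inverse (3::'a)"
  have h: "3 * h = 1" "\<And>z. z / 3 = z * h"
    using r(3) by (auto simp: h_def field_simps)
  define A B where "A = 3*a - 1" and "B = a * (\<rho> - 1) * (a - (\<rho> + 1) / 3)"
  have "A^3 - 27*B = (3 * (a - \<rho> / 3))^3"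
    using r(1) h(1) unfolding A_def B_def h(2) by algebra
  moreover have "discriminant (family_curve \<rho> a) = B^3 * (A^3 - 27*B)"
    unfolding family_curve_def A_def[symmetric] B_def[symmetric] discriminant.simps Let_def
    by (simp add: eval_nat_numeral algebra_simps)
  ultimately have "discriminant (family_curve \<rho> a) = B^3 * (3 * (a - \<rho> / 3))^3"
    by (simp only:)
  moreover have "B \<noteq> 0" "a - \<rho> / 3 \<noteq> 0"
    using a r(2) by (auto simp: B_def)
  ultimately show ?thesis
    using r(3) unfolding elliptic_curve_def by (simp only: power_eq_0_iff mult_eq_0_iff) simp
qed

text \<open>The origin and \<open>(k*c, k*c^2)\<close> are both flexes. The origin and its negative
  have abscissa 0, so \<open>k*c\<close> being nonzero makes the two flexes independent.\<close>

lemma noncyclic_family_curve: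
  fixes \<rho> :: "'a::field"
  assumes \<rho>: "primitive_root_of_unity 3 \<rho>"
    and a: "a * (a - (\<rho> + 1) / 3) * (a - \<rho> / 3) \<noteq> 0"
  shows "\<not> cyclic_group (torsion3 (family_curve \<rho> a))"
proof -
  note r = primitive_cube_root[OF \<rho>]
  define h where "h = inverse (3::'a)"
  have h: "3 * h = 1" "\<And>z. z / 3 = z * h"
    using r(3) by (auto simp: h_def field_simps)
  define A B where "A = 3*a - 1" and "B = a * (\<rho> - 1) * (a - (\<rho> + 1) / 3)"
  \<comment> \<open>These are the parameters of \<open>family_parameter\<close> at scale
    \<open>u = 1\<close>. The three excluded values of \<open>a\<close> are the zeros of
    \<open>k\<close>, \<open>c\<close> and \<open>k + c\<close>.\<close>
  define k c where "k = (1 - \<rho>^2) * a" and "c = (\<rho> - 1) * (a - (\<rho> + 1) / 3)"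
  have E: "family_curve \<rho> a = Weierstrass A 0 B 0 0"
    by (simp add: family_curve_def A_def B_def)
  have "1 - \<rho>^2 = (\<rho> - 1) * \<rho>^2"
    using r(1) by algebra
  moreover have \<rho>0: "\<rho> \<noteq> 0"
    using r(1) by auto
  ultimately have nz: "B \<noteq> 0" "k \<noteq> 0" "c \<noteq> 0"
    using a r(2) by (auto simp: B_def k_def c_def)
  have kc: "k + c = \<rho> * (1 - \<rho>) * (a - \<rho> / 3)"
    using r(1) h(1) unfolding k_def c_def h(2) by algebra
  have AB: "A = (1 - \<rho>^2)*k + (\<rho> - 1)*c" "B = k*c*(k - c - A)"
    using r(1) h(1) unfolding A_def B_def k_def c_def h(2) by algebra+
  have D: "2*(k*c^2) + A*(k*c) + B = k*c*(k + c)"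
    unfolding AB(2) by algebra
  have "Affine 0 0 \<in> carrier (torsion3 (family_curve \<rho> a))"
    using nz unfolding E Affine_in_torsion3_iff[OF refl] by simp
  moreover have "Affine (k*c) (k*c^2) \<in> carrier (torsion3 (family_curve \<rho> a))"
    unfolding E Affine_in_torsion3_iff[OF refl]
  proof (intro conjI)
    show "on_curve (Weierstrass A 0 B 0 0) (k*c) (k*c^2)"
      unfolding on_curve.simps AB(2) by algebra
    show "2*(k*c^2) + A*(k*c) + B \<noteq> 0"
      using nz a r(2) \<rho>0 unfolding D kc by simp
    show "(3*(k*c)^2 + 2*0*(k*c) + 0 - A*(k*c^2))^2
        + A*(3*(k*c)^2 + 2*0*(k*c) + 0 - A*(k*c^2)) * (2*(k*c^2) + A*(k*c) + B)
        = (0 + 3*(k*c)) * (2*(k*c^2) + A*(k*c) + B)^2"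
      using r(1) unfolding D unfolding AB(1) by algebra
  qed
  ultimately show ?thesis
    unfolding noncyclic_torsion3_iff using nz unfolding E
    by (intro exI[of _ "Affine 0 0"] exI[of _ "Affine (k*c) (k*c^2)"]) simp
qed

section \<open>Normal form of a curve with two independent flexes\<close>

lemma flex_parameters:
  fixes \<rho> A B x y :: "'a::field"
  assumes \<rho>: "\<rho>^2 + \<rho> + 1 = 0"
    and curve: "y^2 + A*x*y + B*y = x^3" and "x \<noteq> 0"
    and D: "2*y + A*x + B \<noteq> 0"
    and flex: "(3*x^2 - A*y)^2 + A*(3*x^2 - A*y)*(2*y + A*x + B) = 3*x*(2*y + A*x + B)^2"
  obtains k c where "k \<noteq> 0" "c \<noteq> 0" "k + c \<noteq> 0"
    "A = (1 - \<rho>^2)*k + (\<rho> - 1)*c" "B = k*c*(k - c - A)"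
proof -
  \<comment> \<open>\<open>c\<close> is the slope of the line from the origin to the flex, and
    \<open>-k\<close> the slope of the line to its negative. The equation
    \<open>y * (y + A*x + B) = x^3\<close> then reads \<open>x = k*c\<close>.\<close>
  define c k where "c = y / x" and "k = (y + A*x + B) / x"
  have yc: "y = c*x" and yk: "y + A*x + B = k*x"
    using \<open>x \<noteq> 0\<close> by (simp_all add: c_def k_def)
  have "(k*c - x) * x^2 = 0"
    using curve yc yk by algebra
  then have x: "x = k*c"
    using \<open>x \<noteq> 0\<close> by simp
  then have nz: "k \<noteq> 0" "c \<noteq> 0"
    using \<open>x \<noteq> 0\<close> by auto
  have y: "y = k*c^2"
    using yc x by algebra
  have B: "B = k*c*(k - c - A)"
    using yk y x by algebra
  have D': "2*y + A*x + B = k*c*(k + c)"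
    using B y x by algebra
  have kc: "k + c \<noteq> 0"
    using D D' by auto
  \<comment> \<open>The flex equation is quadratic in \<open>A\<close>; its two roots are exchanged
    by replacing \<open>\<rho>\<close> with the other root \<open>\<rho>^2\<close>.\<close>
  have "k^3 * c^3 * ((A - ((1 - \<rho>^2)*k + (\<rho> - 1)*c)) * (A - ((1 - \<rho>)*k + (\<rho>^2 - 1)*c))) = 0"
    using flex \<rho> unfolding D' unfolding x y by algebra
  then consider "A = (1 - \<rho>^2)*k + (\<rho> - 1)*c" | "A = (1 - \<rho>)*k + (\<rho>^2 - 1)*c"
    using nz by auto
  then show thesis
  proof cases
    case 1
    then show thesis
      using that nz kc B by blast
  next
    case 2
    show thesis
    \<comment> \<open>Passing to the negative flex turns the second root into the first.\<close>
    proof (rule that[of "- c" "- k"])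
      have "- c + - k = - (k + c)"
        by simp
      then show "- c + - k \<noteq> 0"
        using kc by (simp only: neg_equal_0_iff_equal not_False_eq_True)
      show "A = (1 - \<rho>^2)*(- c) + (\<rho> - 1)*(- k)"
        unfolding 2 by algebra
      show "B = (- c)*(- k)*((- c) - (- k) - A)"
        unfolding B by algebra
    qed (use nz in auto)
  qed
qed

text \<open>Each coefficient \<open>ai\<close> scales with weight \<open>i\<close>, so a
  substitution without scaling followed by a scaling is a single change of variables.\<close>

lemma change_of_variables_scale:
  assumes "change_of_variables 1 r s t E = Weierstrass (u*b1) (u^2*b2) (u^3*b3) (u^4*b4) (u^6*b6)"
    and "u \<noteq> 0"
  shows "change_of_variables u r s t E = Weierstrass b1 b2 b3 b4 b6"
  using assms by (cases E) simp

text \<open>Substituting \<open>x = x' + x0\<close>, \<open>y = y' + l*x' + y0\<close> makes the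
  tangent at the flex the line \<open>y' = 0\<close>. It meets the curve three times at the origin,
  so only \<open>x'^3\<close> remains on the right.\<close>

lemma flex_to_origin:
  assumes "Affine x0 y0 \<in> carrier (torsion3 E)"
  obtains r s t A B where "change_of_variables 1 r s t E = Weierstrass A 0 B 0 0" "B \<noteq> 0"
    "\<And>x y. Affine x y \<in> carrier (torsion3 E) \<Longrightarrow> Affine x y \<noteq> Affine x0 y0 \<Longrightarrow>
       Affine x y \<noteq> point_neg E (Affine x0 y0) \<Longrightarrow>
       \<exists>x' y'. x' \<noteq> 0 \<and> Affine x' y' \<in> carrier (torsion3 (Weierstrass A 0 B 0 0))"
proof -
  obtain a1 a2 a3 a4 a6 where E: "E = Weierstrass a1 a2 a3 a4 a6"
    by (cases E)
  define D N where "D = 2*y0 + a1*x0 + a3" and "N = 3*x0^2 + 2*a2*x0 + a4 - a1*y0"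
  define l where "l = N / D"
  have curve: "y0^2 + a1*x0*y0 + a3*y0 = x0^3 + a2*x0^2 + a4*x0 + a6" and "D \<noteq> 0"
    and "N^2 + a1*N*D = (a2 + 3*x0)*D^2"
    using assms unfolding E Affine_in_torsion3_iff[OF refl] on_curve.simps D_def N_def by auto
  moreover have N: "N = l*D"
    using \<open>D \<noteq> 0\<close> by (simp add: l_def)
  ultimately have "(l^2 + a1*l - (a2 + 3*x0)) * D^2 = 0"
    by algebra
  then have l: "l^2 + a1*l = a2 + 3*x0"
    using \<open>D \<noteq> 0\<close> by simp
  have trans: "change_of_variables 1 x0 l y0 E = Weierstrass (a1 + 2*l) 0 D 0 0"
  proof -
    \<comment> \<open>The new \<open>a2\<close>, \<open>a4\<close> and \<open>a6\<close> vanish by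
      the flex equation, the choice of the slope \<open>l\<close>, and incidence with the curve,
      respectively.\<close>
    have "a2 - l*a1 + 3*x0 - l^2 = 0"
      using l by algebra
    moreover have "a3 + x0*a1 + 2*y0 = D"
      unfolding D_def by algebra
    moreover have "a4 - l*a3 + 2*x0*a2 - (y0 + x0*l)*a1 + 3*x0^2 - 2*l*y0 = 0"
      using N unfolding N_def D_def by algebra
    moreover have "a6 + x0*a4 + x0^2*a2 + x0^3 - y0*a3 - y0^2 - x0*y0*a1 = 0"
      using curve by algebra
    ultimately show ?thesis
      unfolding E by simp
  qed
  show thesis
  proof (rule that[OF trans \<open>D \<noteq> 0\<close>])
    fix x y
    assume "Affine x y \<in> carrier (torsion3 E)" and ne: "Affine x y \<noteq> Affine x0 y0"
      "Affine x y \<noteq> point_neg E (Affine x0 y0)"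
    then have xy: "on_curve E x y" "2*y + a1*x + a3 \<noteq> 0"
      "(3*x^2 + 2*a2*x + a4 - a1*y)^2 + a1*(3*x^2 + 2*a2*x + a4 - a1*y)*(2*y + a1*x + a3)
        = (a2 + 3*x)*(2*y + a1*x + a3)^2"
      unfolding E Affine_in_torsion3_iff[OF refl] by auto
    \<comment> \<open>For fixed abscissa the curve is quadratic in \<open>y\<close>, with roots
      belonging to the first flex and its negative.\<close>
    have "x \<noteq> x0"
    proof
      assume "x = x0"
      then have "y^2 + a1*x0*y + a3*y = y0^2 + a1*x0*y0 + a3*y0"
        using curve xy(1) unfolding E by simp
      then have "(y - y0) * (y - (- y0 - a1*x0 - a3)) = 0"
        by algebra
      then show False
        using ne \<open>x = x0\<close> unfolding E by auto
    qed
    define x' y' where "x' = x - x0" and "y' = y - y0 - l*x'"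
    have D': "2*y' + (a1 + 2*l)*x' + D = 2*y + a1*x + a3"
      unfolding x'_def y'_def D_def by algebra
    \<comment> \<open>The substitution lowers every tangent slope by \<open>l\<close> and keeps its
      denominator.\<close>
    have N': "3*x'^2 - (a1 + 2*l)*y' = 3*x^2 + 2*a2*x + a4 - a1*y - l*(2*y + a1*x + a3)"
      using l N unfolding x'_def y'_def D_def N_def by algebra
    have "Affine x' y' \<in> carrier (torsion3 (Weierstrass (a1 + 2*l) 0 D 0 0))"
      unfolding Affine_in_torsion3_iff[OF refl]
    proof (intro conjI)
      show "on_curve (Weierstrass (a1 + 2*l) 0 D 0 0) x' y'"
        using xy(1) on_curve_change_of_variables[of 1 x0 l y0 E x' y']
        unfolding trans by (simp add: x'_def y'_def)
      show "2*y' + (a1 + 2*l)*x' + D \<noteq> 0"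
        using xy(2) D' by simp
      have "(3*x'^2 - (a1 + 2*l)*y')^2
          + (a1 + 2*l)*(3*x'^2 - (a1 + 2*l)*y')*(2*y' + (a1 + 2*l)*x' + D)
        = 3*x'*(2*y' + (a1 + 2*l)*x' + D)^2"
        using xy(3) l unfolding N' D' unfolding x'_def by algebra
      then show "(3*x'^2 + 2*0*x' + 0 - (a1 + 2*l)*y')^2
          + (a1 + 2*l)*(3*x'^2 + 2*0*x' + 0 - (a1 + 2*l)*y')*(2*y' + (a1 + 2*l)*x' + D)
        = (0 + 3*x')*(2*y' + (a1 + 2*l)*x' + D)^2"
        by simp
    qed
    moreover have "x' \<noteq> 0"
      using \<open>x \<noteq> x0\<close> by (simp add: x'_def)
    ultimately show "\<exists>x' y'. x' \<noteq> 0 \<and> Affine x' y' \<in> carrier (torsion3 (Weierstrass (a1 + 2*l) 0 D 0 0))"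
      by blast
  qed
qed

lemma family_parameter:
  fixes \<rho> k c A B :: "'a::field"
  assumes \<rho>: "primitive_root_of_unity 3 \<rho>"
    and nz: "k \<noteq> 0" "c \<noteq> 0" "k + c \<noteq> 0" "B \<noteq> 0"
    and A: "A = (1 - \<rho>^2)*k + (\<rho> - 1)*c" and B: "B = k*c*(k - c - A)"
  obtains u a where "u \<noteq> 0" "a * (a - (\<rho> + 1) / 3) * (a - \<rho> / 3) \<noteq> 0"
    "A = u * (3*a - 1)" "B = u^3 * (a * (\<rho> - 1) * (a - (\<rho> + 1) / 3))"
proof -
  note r = primitive_cube_root[OF \<rho>]
  define h where "h = inverse (3::'a)"
  have h: "3 * h = 1" "\<And>z. z / 3 = z * h"
    using r(3) by (auto simp: h_def field_simps)
  \<comment> \<open>The product of \<open>\<rho> - 1\<close> and its conjugate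
    \<open>\<rho>^2 - 1\<close> is 3.\<close>
  have inv: "(\<rho> - 1) * ((\<rho>^2 - 1) * h) = 1"
    using r(1) h(1) by algebra
  \<comment> \<open>Obtained by eliminating \<open>a\<close> from the required
    \<open>k = (1 - \<rho>^2)*u*a\<close> and
    \<open>c = (\<rho> - 1)*u*(a - (\<rho> + 1)/3)\<close>.\<close>
  define u where "u = 3 * \<rho> * (c - \<rho>*k) * ((\<rho>^2 - 1) * h)"
  have u: "(\<rho> - 1)*u = 3*\<rho>*(c - \<rho>*k)"
    using inv unfolding u_def by algebra
  \<comment> \<open>The last factor is, up to a unit, \<open>u\<close>; so \<open>u\<close> is
    nonzero because \<open>B\<close> is.\<close>
  have "B = k*c*\<rho>*(\<rho>*k - c)"
    unfolding B A by algebra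
  then have "\<rho>*k - c \<noteq> 0"
    using nz(4) by auto
  moreover have "\<rho> \<noteq> 0"
    using r(1) by auto
  ultimately have "u \<noteq> 0"
    using u r(3) by auto
  define a where "a = k / ((1 - \<rho>^2) * u)"
  have "1 - \<rho>^2 = (\<rho> - 1)*\<rho>^2"
    using r(1) by algebra
  then have "1 - \<rho>^2 \<noteq> 0"
    using r(2) \<open>\<rho> \<noteq> 0\<close> by simp
  then have k: "k = (1 - \<rho>^2)*u*a"
    using \<open>u \<noteq> 0\<close> by (simp add: a_def)
  have c: "c = (\<rho> - 1)*u*(a - (\<rho> + 1) / 3)"
    using r(1) h(1) u k unfolding h(2) by algebra
  have kc: "k + c = \<rho>*(1 - \<rho>)*u*(a - \<rho> / 3)"
    using r(1) h(1) unfolding k c h(2) by algebra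
  show thesis
  proof (rule that[OF \<open>u \<noteq> 0\<close>])
    show "a * (a - (\<rho> + 1) / 3) * (a - \<rho> / 3) \<noteq> 0"
      using nz(1-3) k c kc by auto
    show A': "A = u * (3*a - 1)"
      using r(1) h(1) unfolding A k c h(2) by algebra
    show "B = u^3 * (a * (\<rho> - 1) * (a - (\<rho> + 1) / 3))"
      using r(1) h(1) unfolding B A' k c h(2) by algebra
  qed
qed

text \<open>One flex is moved to the origin, a second one yields \<open>k\<close> and
  \<open>c\<close>, and the scale \<open>u\<close> normalises them to a member of the
  family.\<close>

lemma noncyclic_isomorphic_family_curve:
  fixes \<rho> :: "'a::field"
  assumes \<rho>: "primitive_root_of_unity 3 \<rho>" and nc: "\<not> cyclic_group (torsion3 E)"
  shows "\<exists>a. a * (a - (\<rho> + 1) / 3) * (a - \<rho> / 3) \<noteq> 0 \<and> isomorphic_curves E (family_curve \<rho> a)"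
proof -
  obtain x0 y0 x1 y1 where P: "Affine x0 y0 \<in> carrier (torsion3 E)"
    and Q: "Affine x1 y1 \<in> carrier (torsion3 E)" "Affine x1 y1 \<noteq> Affine x0 y0"
      "Affine x1 y1 \<noteq> point_neg E (Affine x0 y0)"
    using nc unfolding noncyclic_torsion3_iff by (metis point.exhaust)
  obtain r s t A B where trans: "change_of_variables 1 r s t E = Weierstrass A 0 B 0 0"
    and "B \<noteq> 0" and "\<exists>x y. x \<noteq> 0 \<and> Affine x y \<in> carrier (torsion3 (Weierstrass A 0 B 0 0))"
    using flex_to_origin[OF P] Q by metis
  then obtain x y where "x \<noteq> 0" and xy: "Affine x y \<in> carrier (torsion3 (Weierstrass A 0 B 0 0))"
    by blast
  obtain k c where kc: "k \<noteq> 0" "c \<noteq> 0" "k + c \<noteq> 0"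
    "A = (1 - \<rho>^2)*k + (\<rho> - 1)*c" "B = k*c*(k - c - A)"
    by (rule flex_parameters[OF primitive_cube_root(1)[OF \<rho>] _ \<open>x \<noteq> 0\<close>])
       (use xy[unfolded Affine_in_torsion3_iff[OF refl]] in auto)
  obtain u a where u: "u \<noteq> 0" and a: "a * (a - (\<rho> + 1) / 3) * (a - \<rho> / 3) \<noteq> 0"
    and AB: "A = u * (3*a - 1)" "B = u^3 * (a * (\<rho> - 1) * (a - (\<rho> + 1) / 3))"
    using family_parameter[OF \<rho> kc(1-3) \<open>B \<noteq> 0\<close> kc(4,5)] by metis
  have "change_of_variables u r s t E = family_curve \<rho> a"
    unfolding family_curve_def
    by (rule change_of_variables_scale[OF _ u]) (simp add: trans AB)
  then show ?thesis
    using a u unfolding isomorphic_curves_def by metis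
qed

theorem proposition7:
  fixes \<rho> :: "'a::{field,finite}"
  assumes "CARD('a) mod 3 = 1"
    and "primitive_root_of_unity 3 \<rho>"
  shows "(\<forall>a. a * (a - (\<rho> + 1) / 3) * (a - \<rho> / 3) \<noteq> 0 \<longrightarrow>
            elliptic_curve (family_curve \<rho> a) \<and>
            \<not> cyclic_group (torsion_subgroup 3 (point_group (family_curve \<rho> a)))) \<and>
         (\<forall>E :: 'a weierstrass.
            elliptic_curve E \<and> \<not> cyclic_group (torsion_subgroup 3 (point_group E)) \<longrightarrow>
            (\<exists>a. a * (a - (\<rho> + 1) / 3) * (a - \<rho> / 3) \<noteq> 0 \<and>
                 isomorphic_curves E (family_curve \<rho> a)))"
  using elliptic_family_curve[OF assms(2)] noncyclic_family_curve[OF assms(2)]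
    noncyclic_isomorphic_family_curve[OF assms(2)]
  by blast

end
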